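(* Let $x$ be a complex number with $x\neq 0$, $9x^2\neq 1$ and $18x^2\neq 1$, fix a square root $\sqrt{9x^2-1}$, and put $\lambda(x)=3x+\sqrt{9x^2-1}$. Then for every integer $n\geq1$: \begin{gather*} \sum_{k=1}^n{n\choose k}\bigl(\lambda(x)+(-1)^{n-k}\lambda^{-1}(x)\bigr)\left(\frac{18x^2-1}{18x^2\sqrt{9x^2-1}}\right)^{k-1}B_{k}(x)\\ =\left(\frac{18x^2-1}{18x^2}\right)^{n-1}\sum_{k=0}^n{n\choose k}\bigl(1-(-1)^{n-k}\bigr)\left(\frac{3x}{(18x^2-1)\sqrt{9x^2-1}}\right)^{k}C_{2k+1}(x),\\ \sum_{k=1}^n{n\choose k}\bigl(1+(-1)^{n-k}\bigr)\left(\frac{18x^2-1}{18x^2\sqrt{9x^2-1}}\right)^{k-1}B_{k}(x)\\ =\left(\frac{18x^2-1}{18x^2}\right)^{n-1}\sum_{k=0}^n{n\choose k}\bigl(1-(-1)^{n-k}\bigr)\left(\frac{3x}{(18x^2-1)\sqrt{9x^2-1}}\right)^{k}C_{2k}(x),\\ \sum_{k=0}^n{n\choose k}\bigl(1+(-1)^{n-k}\bigr)\left(\frac{3x}{(18x^2-1)\sqrt{9x^2-1}}\right)^{k-1}B_{2k+1}(x)\\ =\left(\frac{18x^2}{18x^2-1}\right)^{n-1}6x\sum_{k=0}^n{n\choose k}\bigl(\lambda(x)-(-1)^{n-k}\lambda^{-1}(x)\bigr)\left(\frac{18x^2-1}{18x^2\sqrt{9x^2-1}}\right)^{k}C_{k}(x),\\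 \sum_{k=1}^n{n\choose k}\bigl(1+(-1)^{n-k}\bigr)\left(\frac{3x}{(18x^2-1)\sqrt{9x^2-1}}\right)^{k-1}B_{2k}(x)\\ =\left(\frac{18x^2}{18x^2-1}\right)^{n-1}6x\sum_{k=0}^n{n\choose k}\bigl(1-(-1)^{n-k}\bigr)\left(\frac{18x^2-1}{18x^2\sqrt{9x^2-1}}\right)^{k}C_{k}(x). \end{gather*}
   Context: The balancing polynomials $B_n(x)$ and Lucas-balancing polynomials $C_n(x)$, $n\geq 0$, are defined by the recurrence $u_n(x)=6xu_{n-1}(x)-u_{n-2}(x)$ for $n\geq 2$, with initial terms $B_0(x)=0$, $B_1(x)=1$ and $C_0(x)=1$, $C_1(x)=3x$. Note $\lambda(x)^{-1}=3x-\sqrt{9x^2-1}$. The same choice of square root is used throughout. The conditions on $x$ only ensure that all denominators are nonzero. *)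

theory Defs
  imports Complex_Main "HOL-Computational_Algebra.Polynomial"
begin

fun balancing_poly :: "nat \<Rightarrow> 'a::comm_ring_1 poly" where
  "balancing_poly 0 = 0"
| "balancing_poly (Suc 0) = 1"
| "balancing_poly (Suc (Suc n)) = [:0, 6:] * balancing_poly (Suc n) - balancing_poly n"

fun lucas_balancing_poly :: "nat \<Rightarrow> 'a::comm_ring_1 poly" where
  "lucas_balancing_poly 0 = 1"
| "lucas_balancing_poly (Suc 0) = [:0, 3:]"
| "lucas_balancing_poly (Suc (Suc n)) =
     [:0, 6:] * lucas_balancing_poly (Suc n) - lucas_balancing_poly n"

abbreviation B :: "nat \<Rightarrow> complex \<Rightarrow> complex" where
  "B n x \<equiv> poly (balancing_poly n) x"

abbreviation C :: "nat \<Rightarrow> complex \<Rightarrow> complex" where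
  "C n x \<equiv> poly (lucas_balancing_poly n) x"

end

(*
  With lam = 3x + s and its inverse 3x - s, the Binet formulas write B and C as combinations of
  lam^k and lam^(-k), so the binomial theorem evaluates both sides in closed form. Put
  r = (18x^2 - 1) / (18x^2), a = r / s and b = 3x / ((18x^2 - 1) s). The closed forms agree because
    1 + a lam = r (1 + b lam^2),               a lam - 1 = r (1 + b lam^(-2)),
    1 + a lam^(-1) = r (b lam^2 - 1),          a lam^(-1) - 1 = r (b lam^(-2) - 1).
*)
theory Submission
  imports Defs
begin

lemma power_recurrence:
  fixes z c :: "'a::comm_ring_1"
  assumes "z\<^sup>2 = c * z - 1"
  shows "z ^ Suc (Suc n) = c * z ^ Suc n - z ^ n"
proof -
  have "z ^ Suc (Suc n) = z\<^sup>2 * z ^ n"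
    by (simp add: power2_eq_square mult.assoc)
  then show ?thesis
    unfolding assms by (simp add: algebra_simps)
qed

text \<open>The numbers 3x + s and 3x - s are the roots of z^2 = 6xz - 1, so their powers obey the
  recurrence defining \<open>C\<close>, and the initial values agree.\<close>

lemma lucas_balancing_binet:
  fixes x s :: complex
  assumes "s\<^sup>2 = 9 * x\<^sup>2 - 1"
  shows "2 * C k x = (3 * x + s) ^ k + (3 * x - s) ^ k"
proof (induction k rule: lucas_balancing_poly.induct)
  case (3 n)
  have "(3 * x + s)\<^sup>2 = 6 * x * (3 * x + s) - 1" "(3 * x - s)\<^sup>2 = 6 * x * (3 * x - s) - 1"
    using assms by algebra+
  note rec = this[THEN power_recurrence, of n]
  have step: "2 * C (Suc (Suc n)) x = 6 * x * (2 * C (Suc n) x) - 2 * C n x"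
    by (simp add: algebra_simps)
  show ?case
    unfolding step rec 3 by (simp only: algebra_simps)
qed simp_all

text \<open>Same argument with the difference of the powers. Keeping the factor 2s on the left
  avoids division, so s = 0 is covered too.\<close>

lemma balancing_binet:
  fixes x s :: complex
  assumes "s\<^sup>2 = 9 * x\<^sup>2 - 1"
  shows "2 * s * B k x = (3 * x + s) ^ k - (3 * x - s) ^ k"
proof (induction k rule: balancing_poly.induct)
  case (3 n)
  have "(3 * x + s)\<^sup>2 = 6 * x * (3 * x + s) - 1" "(3 * x - s)\<^sup>2 = 6 * x * (3 * x - s) - 1"
    using assms by algebra+
  note rec = this[THEN power_recurrence, of n]
  have step: "2 * s * B (Suc (Suc n)) x = 6 * x * (2 * s * B (Suc n) x) - 2 * s * B n x"
    by (simp add: algebra_simps)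
  show ?case
    unfolding step rec 3 by (simp only: algebra_simps)
qed simp_all

text \<open>The \<open>p\<close> part is the binomial expansion of (y + 1)^n, the \<open>q\<close>
  part that of (y + (-1))^n.\<close>

lemma alternating_binomial_sum:
  fixes p q y :: "'a::comm_ring_1"
  shows "(\<Sum>k=0..n. of_nat (n choose k) * (p + (-1) ^ (n - k) * q) * y ^ k)
    = p * (y + 1) ^ n + q * (y - 1) ^ n"
proof -
  have "(y + 1) ^ n = (\<Sum>k=0..n. of_nat (n choose k) * y ^ k)"
    using binomial_ring[of y 1 n] by (simp add: atMost_atLeast0)
  moreover have "(y - 1) ^ n = (\<Sum>k=0..n. of_nat (n choose k) * y ^ k * (-1) ^ (n - k))"
    using binomial_ring[of y "-1" n] by (simp add: atMost_atLeast0)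
  ultimately show ?thesis
    by (simp add: sum_distrib_left flip: sum.distrib) (simp add: algebra_simps)
qed

text \<open>Since y^k u^k = (yu)^k, each of the two powers reduces to the preceding lemma at yu or
  yv. This is the form into which the Binet formulas are fed.\<close>

lemma alternating_binomial_sum_two_powers:
  fixes p q y \<alpha> \<beta> u v :: "'a::comm_ring_1"
  assumes "\<And>k. U k = \<alpha> * u ^ k + \<beta> * v ^ k"
  shows "(\<Sum>k=0..n. of_nat (n choose k) * (p + (-1) ^ (n - k) * q) * y ^ k * U k)
    = \<alpha> * (p * (y * u + 1) ^ n + q * (y * u - 1) ^ n)
      + \<beta> * (p * (y * v + 1) ^ n + q * (y * v - 1) ^ n)"
  unfolding alternating_binomial_sum[symmetric] sum_distrib_left sum.distrib[symmetric]
  by (rule sum.cong) (simp_all add: assms power_mult_distrib algebra_simps)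

text \<open>At k = 0 the factor \<open>U 0\<close> kills the term, so the sum can start at 0 once
  1/y is pulled out.\<close>

lemma sum_shifted_powers:
  fixes y :: "'a::field"
  assumes "y \<noteq> 0" and "U 0 = 0"
  shows "(\<Sum>k=1..n. c k * y ^ (k - 1) * U k) = (\<Sum>k=0..n. c k * y ^ k * U k) / y"
proof -
  have "(\<Sum>k=1..n. c k * y ^ (k - 1) * U k) = (\<Sum>k=1..n. c k * y ^ k * U k / y)"
    using assms(1) by (intro sum.cong) (auto simp: power_diff)
  also have "\<dots> = (\<Sum>k=0..n. c k * y ^ k * U k / y)"
    using assms(2) by (simp add: sum.atLeast_Suc_atMost[of 0])
  finally show ?thesis
    by (simp add: sum_divide_distrib)
qed

theorem theorem6:
  fixes x s lam :: complex and n :: nat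
  assumes "x \<noteq> 0" and "9 * x\<^sup>2 \<noteq> 1" and "18 * x\<^sup>2 \<noteq> 1"
    and "s\<^sup>2 = 9 * x\<^sup>2 - 1"
    and "lam = 3 * x + s"
    and "n \<ge> 1"
  shows
    "(\<Sum>k=1..n. of_nat (n choose k) * (lam + (-1) ^ (n - k) * inverse lam)
          * ((18 * x\<^sup>2 - 1) / (18 * x\<^sup>2 * s)) ^ (k - 1) * B k x)
       = ((18 * x\<^sup>2 - 1) / (18 * x\<^sup>2)) ^ (n - 1)
          * (\<Sum>k=0..n. of_nat (n choose k) * (1 - (-1) ^ (n - k))
               * (3 * x / ((18 * x\<^sup>2 - 1) * s)) ^ k * C (2 * k + 1) x)
     \<and>
     (\<Sum>k=1..n. of_nat (n choose k) * (1 + (-1) ^ (n - k))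
          * ((18 * x\<^sup>2 - 1) / (18 * x\<^sup>2 * s)) ^ (k - 1) * B k x)
       = ((18 * x\<^sup>2 - 1) / (18 * x\<^sup>2)) ^ (n - 1)
          * (\<Sum>k=0..n. of_nat (n choose k) * (1 - (-1) ^ (n - k))
               * (3 * x / ((18 * x\<^sup>2 - 1) * s)) ^ k * C (2 * k) x)
     \<and>
     (\<Sum>k=0..n. of_nat (n choose k) * (1 + (-1) ^ (n - k))
          * (3 * x / ((18 * x\<^sup>2 - 1) * s)) powi (int k - 1) * B (2 * k + 1) x)
       = (18 * x\<^sup>2 / (18 * x\<^sup>2 - 1)) ^ (n - 1) * (6 * x)
          * (\<Sum>k=0..n. of_nat (n choose k) * (lam - (-1) ^ (n - k) * inverse lam)
               * ((18 * x\<^sup>2 - 1) / (18 * x\<^sup>2 * s)) ^ k * C k x)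
     \<and>
     (\<Sum>k=1..n. of_nat (n choose k) * (1 + (-1) ^ (n - k))
          * (3 * x / ((18 * x\<^sup>2 - 1) * s)) ^ (k - 1) * B (2 * k) x)
       = (18 * x\<^sup>2 / (18 * x\<^sup>2 - 1)) ^ (n - 1) * (6 * x)
          * (\<Sum>k=0..n. of_nat (n choose k) * (1 - (-1) ^ (n - k))
               * ((18 * x\<^sup>2 - 1) / (18 * x\<^sup>2 * s)) ^ k * C k x)"
proof -
  define m where "m = 3 * x - s"
  define D where "D = 18 * x\<^sup>2 - 1"
  define r where "r = D / (18 * x\<^sup>2)"
  define a where "a = D / (18 * x\<^sup>2 * s)"
  define b where "b = 3 * x / (D * s)"
  have s0: "s \<noteq> 0" and D0: "D \<noteq> 0" and x0: "x \<noteq> 0"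
    using assms by (auto simp: D_def)
  have lm: "lam * m = 1"
    unfolding assms(5) m_def using assms(4) by algebra
  then have inv: "inverse lam = m"
    by (metis inverse_unique)
  have nz: "a \<noteq> 0" "b \<noteq> 0" "r \<noteq> 0"
    using s0 D0 x0 by (auto simp: a_def b_def r_def)
  have sa: "s * a = r"
    using s0 x0 by (simp add: a_def r_def)
  \<comment> \<open>The product r s b is 3x / (18x^2); this is the origin of the factor 6x in the
    last two identities.\<close>
  have rsb: "6 * x * (r * s * b) = 1"
    using s0 x0 D0 by (simp add: b_def r_def power2_eq_square field_simps)
  have base: "a * lam + 1 = r * (b * lam\<^sup>2 + 1)" "a * lam - 1 = r * (b * m\<^sup>2 + 1)"
    "a * m + 1 = r * (b * lam\<^sup>2 - 1)" "a * m - 1 = r * (b * m\<^sup>2 - 1)"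
  proof -
    \<comment> \<open>Clearing denominators turns the quotients into polynomial relations, from
      which \<open>algebra\<close> derives each identity multiplied by 18x^2 s; that nonzero factor
      is then cancelled.\<close>
    have ab: "18 * x\<^sup>2 * s * a = D" "18 * x\<^sup>2 * r = D" "18 * x\<^sup>2 * s * (r * b) = 3 * x"
      using s0 x0 D0 by (simp_all add: a_def r_def b_def)
    have nz': "18 * x\<^sup>2 * s \<noteq> 0"
      using s0 x0 by simp
    have "18 * x\<^sup>2 * s * (a * lam + 1) = 18 * x\<^sup>2 * s * (r * (b * lam\<^sup>2 + 1))"
      "18 * x\<^sup>2 * s * (a * lam - 1) = 18 * x\<^sup>2 * s * (r * (b * m\<^sup>2 + 1))"
      "18 * x\<^sup>2 * s * (a * m + 1) = 18 * x\<^sup>2 * s * (r * (b * lam\<^sup>2 - 1))"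
      "18 * x\<^sup>2 * s * (a * m - 1) = 18 * x\<^sup>2 * s * (r * (b * m\<^sup>2 - 1))"
      using ab assms(4,5) m_def D_def by algebra+
    then show "a * lam + 1 = r * (b * lam\<^sup>2 + 1)" "a * lam - 1 = r * (b * m\<^sup>2 + 1)"
      "a * m + 1 = r * (b * lam\<^sup>2 - 1)" "a * m - 1 = r * (b * m\<^sup>2 - 1)"
      using nz' by (simp_all only: mult_cancel_left simp_thms)
  qed
  have B: "B k x = 1 / (2 * s) * lam ^ k + (- 1 / (2 * s)) * m ^ k" for k
    using balancing_binet[OF assms(4), of k] s0 by (simp add: assms(5) m_def field_simps)
  have C: "C k x = 1 / 2 * lam ^ k + 1 / 2 * m ^ k" for k
    using lucas_balancing_binet[OF assms(4), of k] by (simp add: assms(5) m_def field_simps)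
  have B2: "B (2 * k) x = 1 / (2 * s) * (lam\<^sup>2) ^ k + (- 1 / (2 * s)) * (m\<^sup>2) ^ k" for k
    unfolding B power_mult ..
  have C2: "C (2 * k) x = 1 / 2 * (lam\<^sup>2) ^ k + 1 / 2 * (m\<^sup>2) ^ k" for k
    unfolding C power_mult ..
  \<comment> \<open>For odd indices the surplus factor \<open>lam\<close> or \<open>m\<close> moves
    into the coefficient; it produces the weights that appear on the other side of the first and
    third identities.\<close>
  have B3: "B (2 * k + 1) x = lam / (2 * s) * (lam\<^sup>2) ^ k + (- m / (2 * s)) * (m\<^sup>2) ^ k" for k
    unfolding B power_add power_mult by (simp add: mult.commute)
  have C3: "C (2 * k + 1) x = lam / 2 * (lam\<^sup>2) ^ k + m / 2 * (m\<^sup>2) ^ k" for k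
    unfolding C power_add power_mult by (simp add: mult.commute)
  note BS = alternating_binomial_sum_two_powers[where U = "\<lambda>k. B k x", OF B]
    alternating_binomial_sum_two_powers[where U = "\<lambda>k. B (2 * k) x", OF B2]
    alternating_binomial_sum_two_powers[where U = "\<lambda>k. B (2 * k + 1) x", OF B3]
  note CS = alternating_binomial_sum_two_powers[where U = "\<lambda>k. C k x", OF C]
    alternating_binomial_sum_two_powers[where U = "\<lambda>k. C (2 * k) x", OF C2]
    alternating_binomial_sum_two_powers[where U = "\<lambda>k. C (2 * k + 1) x", OF C3]
  \<comment> \<open>Here n \<ge> 1 matters: subtraction on naturals truncates at 0.\<close>
  have rn: "r ^ n = r * r ^ (n - 1)" "(1 / r) ^ (n - 1) * r ^ n = r"
    using assms(6) nz by (cases n; simp add: power_one_over field_simps)+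
  have signs: "1 + (-1) ^ j = (1 + (-1) ^ j * 1 :: complex)"
    "1 - (-1) ^ j = (1 + (-1) ^ j * (-1) :: complex)"
    "lam - (-1) ^ j * m = lam + (-1) ^ j * (- m)" for j :: nat
    by simp_all
  have B0: "B 0 x = 0" "B (2 * 0) x = 0"
    by simp_all
  \<comment> \<open>All sums become combinations of \<open>F\<close> and \<open>G\<close>. By
    \<open>base\<close>, the sign in the sums over powers of \<open>a\<close> trades places with the
    choice between \<open>lam\<close> and \<open>m\<close>: there \<open>p\<close> and
    \<open>q\<close> are the sign weights, while in the sums over powers of \<open>b\<close> they
    come from the Binet coefficients.\<close>
  define F where "F p q = p * (b * lam\<^sup>2 + 1) ^ n + q * (b * m\<^sup>2 + 1) ^ n" for p q :: complex
  define G where "G p q = p * (b * lam\<^sup>2 - 1) ^ n + q * (b * m\<^sup>2 - 1) ^ n" for p q :: complex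
  have E1: "(\<Sum>k=1..n. of_nat (n choose k) * (p + (-1) ^ (n - k) * q) * a ^ (k - 1) * B k x)
      = r ^ (n - 1) / 2 * (F p q - G p q)" for p q
    unfolding sum_shifted_powers[where U = "\<lambda>k. B k x", OF nz(1) B0(1)] BS base
      power_mult_distrib F_def G_def rn(1)
    using nz s0 by (simp add: sa[symmetric] field_simps)
  have E2: "(\<Sum>k=0..n. of_nat (n choose k) * (p + (-1) ^ (n - k) * q) * a ^ k * C k x)
      = r ^ n / 2 * (F p q + G p q)" for p q
    unfolding CS base power_mult_distrib F_def G_def by (simp add: field_simps)
  have E3: "(\<Sum>k=0..n. of_nat (n choose k) * (1 + (-1) ^ (n - k) * q) * b ^ k * C (2 * k + 1) x)
      = (F lam m + q * G lam m) / 2" for q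
    unfolding CS F_def G_def by (simp add: field_simps)
  have E4: "(\<Sum>k=0..n. of_nat (n choose k) * (1 + (-1) ^ (n - k) * q) * b ^ k * C (2 * k) x)
      = (F 1 1 + q * G 1 1) / 2" for q
    unfolding CS F_def G_def by (simp add: field_simps)
  \<comment> \<open>With odd indices the k = 0 term does not start from a zero value of
    \<open>B\<close>, and its exponent really is -1, so \<open>sum_shifted_powers\<close> does not
    apply.\<close>
  have pw: "b powi (int k - 1) = b ^ k / b" for k
    using nz by (simp add: power_int_diff)
  have E5: "(\<Sum>k=0..n. of_nat (n choose k) * (1 + (-1) ^ (n - k) * 1) * b powi (int k - 1) * B (2 * k + 1) x)
      = (F lam (- m) + G lam (- m)) / (2 * s * b)"
  proof -
    have "(\<Sum>k=0..n. of_nat (n choose k) * (1 + (-1) ^ (n - k) * 1) * b powi (int k - 1) * B (2 * k + 1) x)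
      = (\<Sum>k=0..n. of_nat (n choose k) * (1 + (-1) ^ (n - k) * 1) * b ^ k * B (2 * k + 1) x) / b"
      unfolding pw sum_divide_distrib by (rule sum.cong) simp_all
    also have "\<dots> = (F lam (- m) + G lam (- m)) / (2 * s * b)"
      unfolding BS F_def G_def using nz s0 by (simp add: field_simps)
    finally show ?thesis .
  qed
  have E6: "(\<Sum>k=1..n. of_nat (n choose k) * (1 + (-1) ^ (n - k) * 1) * b ^ (k - 1) * B (2 * k) x)
      = (F 1 (- 1) + G 1 (- 1)) / (2 * s * b)"
    unfolding sum_shifted_powers[where U = "\<lambda>k. B (2 * k) x", OF nz(2) B0(2)] BS F_def G_def
    using nz s0 by (simp add: field_simps)
  have sb: "1 / (s * b) = 6 * x * r"
    using rsb nz s0 by (simp add: field_simps)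
  \<comment> \<open>Rewrites the closed forms \<open>E5\<close> and \<open>E6\<close> into the
    prefactor of the right-hand side times the closed form \<open>E2\<close>.\<close>
  have K: "X / (2 * s * b) = (1 / r) ^ (n - 1) * (6 * x) * (r ^ n / 2 * X)" for X
  proof -
    have "(1 / r) ^ (n - 1) * (6 * x) * (r ^ n / 2 * X) = 6 * x * ((1 / r) ^ (n - 1) * r ^ n) * X / 2"
      by (simp only: times_divide_eq_right mult_ac)
    also have "\<dots> = X / (2 * s * b)"
      unfolding rn(2) sb[symmetric] by simp
    finally show ?thesis ..
  qed
  have r': "18 * x\<^sup>2 / D = 1 / r"
    by (simp add: r_def)
  \<comment> \<open>In order, both sides reduce to multiples of F - G at (lam, m), F - G at (1, 1),
    F + G at (lam, -m) and F + G at (1, -1).\<close>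
  show ?thesis
    unfolding inv D_def[symmetric] a_def[symmetric] b_def[symmetric] r' r_def[symmetric]
      signs E1 E2 E3 E4 E5 E6 K
    by simp
qed

end
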